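(* Let $k\supset\mathbb R$ be an ordered field, and let $\mu$ be a finitely additive real-valued probability measure defined on an algebra $\mathcal A$ of subsets of $\mathbb R^n$, giving measure zero to all singletons. Then there exists a fine filter $F$ on $[k^n_{fin}]^{<\omega}$ such that for every standardizable $f:k^n_{fin}\to k$, if $\mathrm{st} f$ is a bounded $\mu$-measurable function, then $f$ has a standard $F$-integral and $$\mathrm{st}\!\int f\,dF=\int\mathrm{st} f\,d\mu.$$
   Context: An element $a$ of $k$ is finite if $-m<a<m$ for some $m\in\mathbb N$; $k^n_{fin}$ is the set of $n$-tuples of finite elements of $k$. For $a,b\in k$, $a\sim b$ means $a-b$ is infinitesimal (i.e. $-1<m(a-b)<1$ for all $m\in\mathbb Z$); for tuples, $\sim$ is coordinatewise. Each finite $a\in k$ has a unique real standard part $\mathrm{st}\,a\sim a$; for tuples, $\mathrm{st}$ is coordinatewise, and $\mathrm{st} X=\{\mathrm{st}\,x:x\in X\}$. For $X\subseteq k^n_{fin}$, a function $f:X\to k^m$ is standardizable if $f(x)\sim f(y)$ whenever $x,y\in X$ and $x\sim y$, and $f(x)$ is finite for every $x\in X$. Its standard part $\mathrm{st} f:\mathrm{st} X\to\mathbb R^m$ is $\mathrm{st} f(x)=\mathrm{st}(f(y))$ for any $y\in X$ with $\mathrm{st}\,y=x$. $[X]^{<\omega}$ is the set of finite subsets of $X$; a (proper) filter $F$ over $[X]^{<\omega}$ is fine if $\{z:x\in z\}\in F$ for all $x\in X$. $\mathrm{Pow}(k,F)$ is the set of functions $[X]^{<\omega}\to k$ modulo agreeing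 on a set in $F$, with pointwise ring operations, $[g]_F<[h]_F$ iff $\{z:g(z)<h(z)\}\in F$, and $k$ embedded via constants. $\int f\,dF=\left[z\mapsto\frac1{|z|}\sum_{x\in z}f(x)\right]_F\in\mathrm{Pow}(k,F)$. For $a\in\mathrm{Pow}(k,F)$, $\mathrm{st}^+a=\inf\{q\in\mathbb Q:a<q\}$, $\mathrm{st}^-a=\sup\{q\in\mathbb Q:q<a\}$ (conventions $\inf\emptyset=\sup\mathbb Q=\infty$, $\sup\emptyset=\inf\mathbb Q=-\infty$); if equal, $\mathrm{st}\,a$ is the common value. $f$ has a standard $F$-integral if $\mathrm{st}\!\int f\,dF:=\mathrm{st}(\int f\,dF)$ is defined. A bounded $g:\mathbb R^n\to\mathbb R$ is $\mu$-measurable if $\{x:a<g(x)\le b\}\in\mathcal A$ for all reals $a<b$, and $\int g\,d\mu$ is the usual limit of integrals of approximating simple functions. *)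

theory Defs
  imports "HOL-Analysis.Analysis"
begin

text \<open>
  An ordered field extending the reals is a type of sort
  \<open>{linordered_field, real_algebra_1}\<close>, with \<open>of_real\<close> as the inclusion.
  Every ring homomorphism from the reals to an ordered field preserves the order,
  because nonnegative reals are squares.
\<close>

lemma of_real_less_iff_ordered_field:
  fixes x y :: real
  shows "(of_real x :: 'k::{linordered_field, real_algebra_1}) < of_real y \<longleftrightarrow> x < y"
proof -
  have mono: "(of_real a :: 'k) \<le> of_real b" if "a \<le> b" for a b :: real
  proof -
    have "(of_real b :: 'k) - of_real a = of_real (sqrt (b - a)) * of_real (sqrt (b - a))"
      using that by (simp flip: of_real_diff of_real_mult)
    then show ?thesis
      by (metis diff_ge_0_iff_ge zero_le_square)
  qed
  show ?thesis
    using mono[of x y] mono[of y x] of_real_eq_iff[of x y, where ?'a = 'k]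
    by (metis less_le_not_le linorder_le_less_linear order_antisym)
qed


section \<open>Finite elements, infinitesimals and standard parts\<close>

definition fin_elem :: "'k::linordered_field \<Rightarrow> bool" where
  "fin_elem a \<longleftrightarrow> (\<exists>m::nat. - of_nat m < a \<and> a < of_nat m)"

definition fin_vecs :: "('k::linordered_field ^ 'n) set" where
  "fin_vecs = {x. \<forall>i. fin_elem (x $ i)}"

definition infinitesimal :: "'k::linordered_field \<Rightarrow> bool" where
  "infinitesimal d \<longleftrightarrow> (\<forall>m::int. - 1 < of_int m * d \<and> of_int m * d < 1)"

definition inf_close :: "'k::linordered_field \<Rightarrow> 'k \<Rightarrow> bool" where
  "inf_close a b \<longleftrightarrow> infinitesimal (a - b)"

definition vec_inf_close :: "'k::linordered_field ^ 'n \<Rightarrow> 'k ^ 'n \<Rightarrow> bool" where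
  "vec_inf_close x y \<longleftrightarrow> (\<forall>i. inf_close (x $ i) (y $ i))"

text \<open>Meaningful for finite elements only.\<close>

definition elem_st :: "'k::{linordered_field, real_algebra_1} \<Rightarrow> real" where
  "elem_st a = (THE r. inf_close a (of_real r))"

definition vec_st :: "'k::{linordered_field, real_algebra_1} ^ 'n \<Rightarrow> real ^ 'n" where
  "vec_st x = (\<chi> i. elem_st (x $ i))"

definition standardizable ::
    "('k::linordered_field ^ 'n) set \<Rightarrow> ('k ^ 'n \<Rightarrow> 'k) \<Rightarrow> bool" where
  "standardizable X f \<longleftrightarrow>
     (\<forall>x\<in>X. \<forall>y\<in>X. vec_inf_close x y \<longrightarrow> inf_close (f x) (f y)) \<and>
     (\<forall>x\<in>X. fin_elem (f x))"

text \<open>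
  The function \<open>fun_st X f\<close> is meaningful on \<open>vec_st ` X\<close> for standardizable \<open>f\<close>. If \<open>X\<close> is
  \<open>fin_vecs\<close>, this is the whole space, since the coordinatewise inclusion of a real vector
  is its own standard part.
\<close>

definition fun_st ::
    "('k::{linordered_field, real_algebra_1} ^ 'n) set \<Rightarrow> ('k ^ 'n \<Rightarrow> 'k) \<Rightarrow> real ^ 'n \<Rightarrow> real" where
  "fun_st X f x = elem_st (f (SOME y. y \<in> X \<and> vec_st y = x))"


section \<open>Fine filters and powers of an ordered field\<close>

text \<open>
  A filter on the finite subsets of \<open>X\<close> is represented by a filter on the type \<open>'a set\<close>
  containing the set of finite subsets of \<open>X\<close>.
\<close>

definition fine_filter :: "'a set \<Rightarrow> 'a set filter \<Rightarrow> bool" where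
  "fine_filter X F \<longleftrightarrow>
     F \<noteq> bot \<and> (\<forall>\<^sub>F z in F. finite z \<and> z \<subseteq> X) \<and> (\<forall>x\<in>X. \<forall>\<^sub>F z in F. x \<in> z)"

text \<open>
  Elements of the power of \<open>'k\<close> along \<open>F\<close> are the equivalence classes \<open>pow_class F g\<close>. A function
  on the finite subsets of \<open>X\<close> may be extended arbitrarily to all of \<open>'a set\<close>, as its
  values outside a set of the filter do not affect its class. The filter need not be an
  ultrafilter, so the order is only partial in general.
\<close>

definition pow_class :: "'i filter \<Rightarrow> ('i \<Rightarrow> 'k) \<Rightarrow> ('i \<Rightarrow> 'k) set" where
  "pow_class F g = {h. \<forall>\<^sub>F z in F. g z = h z}"

definition pow_const :: "'i filter \<Rightarrow> 'k \<Rightarrow> ('i \<Rightarrow> 'k) set" where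
  "pow_const F c = pow_class F (\<lambda>_. c)"

definition pow_less ::
    "'i filter \<Rightarrow> ('i \<Rightarrow> 'k::linordered_field) set \<Rightarrow> ('i \<Rightarrow> 'k) set \<Rightarrow> bool" where
  "pow_less F a b \<longleftrightarrow> (\<exists>g\<in>a. \<exists>h\<in>b. \<forall>\<^sub>F z in F. g z < h z)"

lemma pow_less_class:
  "pow_less F (pow_class F g) (pow_class F h) \<longleftrightarrow> (\<forall>\<^sub>F z in F. g z < h z)"
proof
  assume "pow_less F (pow_class F g) (pow_class F h)"
  then obtain g' h' where "\<forall>\<^sub>F z in F. g z = g' z" "\<forall>\<^sub>F z in F. h z = h' z"
      "\<forall>\<^sub>F z in F. g' z < h' z"
    by (auto simp: pow_less_def pow_class_def)
  then show "\<forall>\<^sub>F z in F. g z < h z"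
    by eventually_elim simp
next
  assume "\<forall>\<^sub>F z in F. g z < h z"
  moreover have "g \<in> pow_class F g" "h \<in> pow_class F h"
    by (simp_all add: pow_class_def)
  ultimately show "pow_less F (pow_class F g) (pow_class F h)"
    unfolding pow_less_def by blast
qed

definition pow_st_plus :: "'i filter \<Rightarrow> ('i \<Rightarrow> 'k::linordered_field) set \<Rightarrow> ereal" where
  "pow_st_plus F a = Inf {ereal (of_rat q) | q. pow_less F a (pow_const F (of_rat q))}"

definition pow_st_minus :: "'i filter \<Rightarrow> ('i \<Rightarrow> 'k::linordered_field) set \<Rightarrow> ereal" where
  "pow_st_minus F a = Sup {ereal (of_rat q) | q. pow_less F (pow_const F (of_rat q)) a}"

definition has_pow_st :: "'i filter \<Rightarrow> ('i \<Rightarrow> 'k::linordered_field) set \<Rightarrow> bool" where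
  "has_pow_st F a \<longleftrightarrow> pow_st_plus F a = pow_st_minus F a"

text \<open>Meaningful under \<open>has_pow_st F a\<close> only.\<close>

definition pow_st :: "'i filter \<Rightarrow> ('i \<Rightarrow> 'k::linordered_field) set \<Rightarrow> ereal" where
  "pow_st F a = (THE s. pow_st_plus F a = s \<and> pow_st_minus F a = s)"

definition filter_integral ::
    "'a set filter \<Rightarrow> ('a \<Rightarrow> 'k::linordered_field) \<Rightarrow> ('a set \<Rightarrow> 'k) set" where
  "filter_integral F f = pow_class F (\<lambda>z. 1 / of_nat (card z) * (\<Sum>x\<in>z. f x))"

definition has_std_integral :: "'a set filter \<Rightarrow> ('a \<Rightarrow> 'k::linordered_field) \<Rightarrow> bool" where
  "has_std_integral F f \<longleftrightarrow> has_pow_st F (filter_integral F f)"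

definition std_integral :: "'a set filter \<Rightarrow> ('a \<Rightarrow> 'k::linordered_field) \<Rightarrow> ereal" where
  "std_integral F f = pow_st F (filter_integral F f)"


section \<open>Integration against a finitely additive probability measure\<close>

definition fin_additive_prob :: "'a set set \<Rightarrow> ('a set \<Rightarrow> real) \<Rightarrow> bool" where
  "fin_additive_prob A \<mu> \<longleftrightarrow>
     algebra UNIV A \<and> additive A \<mu> \<and> (\<forall>S\<in>A. 0 \<le> \<mu> S) \<and> \<mu> UNIV = 1"

definition fa_measurable :: "'a set set \<Rightarrow> ('a \<Rightarrow> real) \<Rightarrow> bool" where
  "fa_measurable A g \<longleftrightarrow> (\<forall>a b. a < b \<longrightarrow> {x. a < g x \<and> g x \<le> b} \<in> A)"

text \<open>
  The library's \<open>simple_function\<close> is tied to sigma-algebras, so its analogue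
  for an algebra of sets is introduced here.
\<close>

definition fa_simple :: "'a set set \<Rightarrow> ('a \<Rightarrow> real) \<Rightarrow> bool" where
  "fa_simple A s \<longleftrightarrow> finite (range s) \<and> (\<forall>c. s -` {c} \<in> A)"

definition fa_simple_integral :: "('a set \<Rightarrow> real) \<Rightarrow> ('a \<Rightarrow> real) \<Rightarrow> real" where
  "fa_simple_integral \<mu> s = (\<Sum>c\<in>range s. c * \<mu> (s -` {c}))"

text \<open>
  Bounded measurable functions are the uniform limits of simple functions that are obtained by
  cutting the range into short half-open intervals. The limit of the integrals does
  not depend on the approximating sequence, as integrals of simple functions differ at most by
  the supremum distance of the functions.
\<close>

definition has_fa_integral ::
    "'a set set \<Rightarrow> ('a set \<Rightarrow> real) \<Rightarrow> ('a \<Rightarrow> real) \<Rightarrow> real \<Rightarrow> bool" where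
  "has_fa_integral A \<mu> g I \<longleftrightarrow>
     (\<exists>s. (\<forall>i. fa_simple A (s i)) \<and> uniform_limit UNIV s g sequentially \<and>
          (\<lambda>i. fa_simple_integral \<mu> (s i)) \<longlonglongrightarrow> I)"

definition fa_integral :: "'a set set \<Rightarrow> ('a set \<Rightarrow> real) \<Rightarrow> ('a \<Rightarrow> real) \<Rightarrow> real" where
  "fa_integral A \<mu> g = (THE I. has_fa_integral A \<mu> g I)"

end

theory Submission
  imports Defs
begin

text \<open>
  Averages over suitable finite sets approximate \<open>\<mu>\<close> on any finitely many members of the
  algebra at once. Finitely many sets \<open>S\<close> generate a finite partition of the space. A cell
  of positive measure is infinite, since finite sets are null, so it contains as many points as
  wanted. Taking about \<open>N * \<mu> c\<close> points from each cell \<open>c\<close> gives a finite set in which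
  every \<open>S\<close> has about \<open>N * \<mu> S\<close> points, with an error independent of \<open>N\<close>
  (\<open>proportional_finite_sets\<close>). For large \<open>N\<close>, neither this error nor any finitely many points
  that one is forced to include affect the proportions by much. The real points lift to
  \<open>k\<close> along the standard part map, so the sets of finite samples that contain given points and
  have given proportions up to a given error have the finite intersection property. The filter
  \<open>F\<close> that they generate is fine, and along it the proportion of points whose standard part is in
  \<open>S\<close> tends to \<open>\<mu> S\<close> (\<open>ex_fine_representative_filter\<close>).

  Along such a filter, the means of \<open>g \<circ> st\<close> for a simple function \<open>g\<close> tend to its integral by
  linearity, and the same follows for bounded measurable \<open>g\<close> by uniform approximation
  (\<open>mean_tendsto_fa_integral\<close>). The filter also shows that the integral of \<open>g\<close> is well defined:
  simple functions at uniform distance at most \<open>e\<close> have means at distance at most \<open>e\<close>, hence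
  integrals at distance at most \<open>e\<close>, and the limit of the means of \<open>g\<close> is unique.

  Finally, a standardizable \<open>f\<close> differs from the real function \<open>st f \<circ> st\<close> by less than every
  positive real, hence so do their means over finite sets. The mean of \<open>f\<close> is therefore
  eventually as close as wanted to the integral of \<open>st f\<close>. This puts every rational other than
  the integral itself on the correct side of \<open>\<integral> f dF\<close>, so the upper and
  the lower standard part both equal the integral.
\<close>

section \<open>Finite sets with prescribed proportions\<close>

definition mean :: "('a \<Rightarrow> real) \<Rightarrow> 'a set \<Rightarrow> real" where
  "mean h z = (\<Sum>x\<in>z. h x) / real (card z)"

lemma fin_additive_prob_sum:
  assumes "fin_additive_prob A \<mu>" "finite I" "B ` I \<subseteq> A" "disjoint_family_on B I"
  shows "\<mu> (\<Union>i\<in>I. B i) = (\<Sum>i\<in>I. \<mu> (B i))"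
proof -
  interpret algebra UNIV A
    using assms(1) by (simp add: fin_additive_prob_def)
  have "additive A \<mu>"
    using assms(1) by (simp add: fin_additive_prob_def)
  from additiveD[OF this, of "{}" "{}"] have "\<mu> {} = 0"
    by simp
  from assms(2-4) show ?thesis
  proof (induction rule: finite_induct)
    case (insert i I)
    then have "B i \<inter> (\<Union>j\<in>I. B j) = {}"
      by (auto simp: disjoint_family_on_def)
    moreover have "B i \<in> A" "(\<Union>j\<in>I. B j) \<in> A"
      using insert.prems insert.hyps by (auto intro!: finite_UN)
    ultimately show ?case
      using insert additiveD[OF \<open>additive A \<mu>\<close>, of "B i" "\<Union>j\<in>I. B j"]
      by (simp add: disjoint_family_on_insert)
  qed (simp add: \<open>\<mu> {} = 0\<close>)
qed

lemma fin_additive_prob_finite_null: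
  assumes "fin_additive_prob A \<mu>" "\<And>x. {x} \<in> A \<and> \<mu> {x} = 0" "finite S"
  shows "\<mu> S = 0"
  using fin_additive_prob_sum[OF assms(1,3), of "\<lambda>x. {x}"] assms(2)
  by (auto simp: disjoint_family_on_def)

text \<open>
  For \<open>K\<close> one takes the number of membership patterns with respect to \<open>T\<close>, because rounding
  costs at most one point for each of them. What matters later is that it does not depend on \<open>N\<close>.
\<close>
lemma proportional_finite_sets:
  assumes prob: "fin_additive_prob A \<mu>" and null: "\<And>x. {x} \<in> A \<and> \<mu> {x} = 0"
    and T: "finite T" "T \<subseteq> A"
  obtains K :: real where
    "\<And>N::nat. \<exists>P. finite P \<and> (\<forall>S\<in>T. \<bar>real (card (P \<inter> S)) - real N * \<mu> S\<bar> \<le> K)"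
proof -
  interpret algebra UNIV A
    using prob by (simp add: fin_additive_prob_def)
  have nonneg: "0 \<le> \<mu> S" if "S \<in> A" for S
    using prob that by (auto simp: fin_additive_prob_def)
  (* A cell may be empty, if no point realizes the pattern c. *)
  define cell where "cell c = {x. \<forall>S\<in>T. x \<in> S \<longleftrightarrow> S \<in> c}" for c :: "'a set set"
  have cell_A: "cell c \<in> A" for c
  proof -
    have "{x. x \<in> S \<longleftrightarrow> S \<in> c} \<in> A" if "S \<in> T" for S
    proof (cases "S \<in> c")
      case True
      then have "{x. x \<in> S \<longleftrightarrow> S \<in> c} = S" by auto
      then show ?thesis using that T by auto
    next
      case False
      then have "{x. x \<in> S \<longleftrightarrow> S \<in> c} = UNIV - S" by auto
      then show ?thesis using that T compl_sets by auto
    qed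
    then show ?thesis
      using sets_Collect_finite_All'[of T "\<lambda>S x. x \<in> S \<longleftrightarrow> S \<in> c"] T top
      by (cases "T = {}") (auto simp: cell_def)
  qed
  have disj: "disjoint_family_on cell (Pow T)"
    unfolding disjoint_family_on_def cell_def by blast
  define J where "J S = {c \<in> Pow T. S \<in> c}" for S
  have J: "finite (J S)" "J S \<subseteq> Pow T" for S
    using T by (auto simp: J_def)
  have cover: "S = (\<Union>c\<in>J S. cell c)" if "S \<in> T" for S
  proof
    show "S \<subseteq> (\<Union>c\<in>J S. cell c)"
    proof
      fix x assume "x \<in> S"
      then have "x \<in> cell {R \<in> T. x \<in> R}" "{R \<in> T. x \<in> R} \<in> J S"
        using that by (auto simp: cell_def J_def)
      then show "x \<in> (\<Union>c\<in>J S. cell c)" by blast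
    qed
  qed (use that in \<open>auto simp: cell_def J_def\<close>)
  have "\<exists>P. finite P \<and>
      (\<forall>S\<in>T. \<bar>real (card (P \<inter> S)) - real N * \<mu> S\<bar> \<le> real (card (Pow T)))" for N :: nat
  proof -
    (* Null singletons matter here: a finite cell of positive measure would not contain
       enough points. *)
    have "\<exists>Q. finite Q \<and> Q \<subseteq> cell c \<and> card Q = nat \<lfloor>real N * \<mu> (cell c)\<rfloor>" for c
    proof (cases "finite (cell c)")
      case True
      then have "\<mu> (cell c) = 0"
        by (rule fin_additive_prob_finite_null[OF prob null])
      then show ?thesis by (intro exI[of _ "{}"]) auto
    next
      case False
      then show ?thesis
        using infinite_arbitrarily_large by blast
    qed
    then obtain Q where Q: "\<And>c. finite (Q c)" "\<And>c. Q c \<subseteq> cell c"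
        "\<And>c. card (Q c) = nat \<lfloor>real N * \<mu> (cell c)\<rfloor>"
      by metis
    have Q_close: "\<bar>real (card (Q c)) - real N * \<mu> (cell c)\<bar> \<le> 1" for c
    proof -
      have "0 \<le> real N * \<mu> (cell c)" using nonneg[OF cell_A] by simp
      then show ?thesis unfolding Q(3) by linarith
    qed
    define P where "P = (\<Union>c\<in>Pow T. Q c)"
    have "\<bar>real (card (P \<inter> S)) - real N * \<mu> S\<bar> \<le> real (card (Pow T))" if S: "S \<in> T" for S
    proof -
      have "P \<inter> S = (\<Union>c\<in>J S. Q c)"
      proof
        show "(\<Union>c\<in>J S. Q c) \<subseteq> P \<inter> S"
          using Q(2) S unfolding P_def J_def cell_def by blast
        show "P \<inter> S \<subseteq> (\<Union>c\<in>J S. Q c)"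
          using Q(2) S unfolding P_def J_def cell_def by blast
      qed
      moreover have "Q c \<inter> Q d = {}" if "c \<in> J S" "d \<in> J S" "c \<noteq> d" for c d
        using disj Q(2) that J(2)[of S] unfolding disjoint_family_on_def by blast
      ultimately have card: "card (P \<inter> S) = (\<Sum>c\<in>J S. card (Q c))"
        using J(1) Q(1) by (simp add: card_UN_disjoint)
      have "disjoint_family_on cell (J S)"
        using disj J(2)[of S] disjoint_family_on_mono by blast
      then have "\<mu> S = (\<Sum>c\<in>J S. \<mu> (cell c))"
        using fin_additive_prob_sum[OF prob J(1), of cell S] cell_A cover[OF S] by auto
      then have "real (card (P \<inter> S)) - real N * \<mu> S
          = (\<Sum>c\<in>J S. real (card (Q c)) - real N * \<mu> (cell c))"
        by (simp add: card sum_subtractf sum_distrib_left)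
      also have "\<bar>\<dots>\<bar> \<le> (\<Sum>c\<in>J S. 1)"
        by (rule order_trans[OF sum_abs]) (intro sum_mono Q_close)
      also have "\<dots> \<le> real (card (Pow T))"
        using card_mono[OF _ J(2)[of S]] T by simp
      finally show ?thesis .
    qed
    then show ?thesis
      using Q(1) T by (intro exI[of _ P]) (auto simp: P_def)
  qed
  then show ?thesis using that by blast
qed

text \<open>
  If the count \<open>c\<close> and the total \<open>n\<close> both have an error of at most \<open>K\<close>, then \<open>c - n * a\<close>
  is at most \<open>2 * K\<close> in absolute value, which is negligible against \<open>n\<close> once \<open>N\<close> is large.
\<close>
lemma quotient_near:
  fixes a c n N K e :: real
  assumes c: "\<bar>c - N * a\<bar> \<le> K" and n: "\<bar>n - N\<bar> \<le> K"
    and a: "0 \<le> a" "a \<le> 1" and e: "0 < e" and N: "K + 2 * K / e < N"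
  shows "\<bar>c / n - a\<bar> < e"
proof -
  have K: "0 \<le> K" using c by linarith
  have "2 * K / e < n" using n N by linarith
  moreover have "0 \<le> 2 * K / e" using K e by simp
  ultimately have n_pos: "0 < n" and n_large: "2 * K < e * n"
    using e by (linarith, simp add: field_simps)
  have "\<bar>(N - n) * a\<bar> \<le> K * 1"
    unfolding abs_mult using n a by (intro mult_mono) auto
  then have "\<bar>c - n * a\<bar> \<le> 2 * K"
    using c by (simp add: algebra_simps)
  also have "\<dots> < e * n" by (rule n_large)
  finally show ?thesis
    using n_pos by (simp add: abs_less_iff field_simps)
qed

text \<open>
  The points of \<open>W\<close> are those that fineness will force into the sample. They add at most
  \<open>card W\<close> to each count and thus only enlarge the error bound of the previous lemmas. The map
  \<open>p\<close> stands for the standard part map, along which the points of the cells are lifted.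
\<close>
lemma ex_representative_sample:
  assumes prob: "fin_additive_prob A \<mu>" and null: "\<And>x. {x} \<in> A \<and> \<mu> {x} = 0"
    and p: "p ` X = UNIV" and T: "finite T" "T \<subseteq> A" and W: "finite W" "W \<subseteq> X" and e: "0 < e"
  shows "\<exists>z. finite z \<and> W \<subseteq> z \<and> z \<subseteq> X \<and> (\<forall>S\<in>T. \<bar>mean (\<lambda>x. indicator S (p x)) z - \<mu> S\<bar> < e)"
proof -
  interpret algebra UNIV A
    using prob by (simp add: fin_additive_prob_def)
  have \<mu>: "0 \<le> \<mu> S" "\<mu> S \<le> 1" if "S \<in> A" for S
  proof -
    have S: "UNIV - S \<in> A" using that compl_sets by auto
    have "\<mu> (S \<union> (UNIV - S)) = \<mu> S + \<mu> (UNIV - S)"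
      using prob that S by (intro additiveD[of A]) (auto simp: fin_additive_prob_def)
    then show "0 \<le> \<mu> S" "\<mu> S \<le> 1"
      using prob that S by (auto simp: fin_additive_prob_def)
  qed
  (* The whole space is added to T so that the size of the sample is controlled as well. *)
  from T obtain K where K: "\<And>N::nat. \<exists>P. finite P \<and>
      (\<forall>S\<in>insert UNIV T. \<bar>real (card (P \<inter> S)) - real N * \<mu> S\<bar> \<le> K)"
    using proportional_finite_sets[OF prob null, of "insert UNIV T"] top
    by (metis finite_insert insert_subset)
  define L where "L = K + real (card W)"
  obtain N :: nat where N: "L + 2 * L / e < N"
    using reals_Archimedean2 by blast
  obtain P where P: "finite P"
      "\<And>S. S \<in> insert UNIV T \<Longrightarrow> \<bar>real (card (P \<inter> S)) - real N * \<mu> S\<bar> \<le> K"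
    using K by blast
  define j where "j = inv_into X p"
  have j: "p (j x) = x" "j x \<in> X" for x
    using p by (auto simp: j_def f_inv_into_f inv_into_into)
  then have inj: "inj j" by (metis injI)
  define z where "z = W \<union> j ` P"
  have z: "finite z" "W \<subseteq> z" "z \<subseteq> X"
    using W P(1) j by (auto simp: z_def)
  have count: "\<bar>real (card {x\<in>z. p x \<in> S}) - real N * \<mu> S\<bar> \<le> L" if "S \<in> insert UNIV T" for S
  proof -
    have "card {x\<in>z. p x \<in> S} \<le> card (W \<union> j ` (P \<inter> S))"
      using W P(1) j by (intro card_mono) (auto simp: z_def)
    also have "\<dots> \<le> card W + card (j ` (P \<inter> S))" by (rule card_Un_le)
    finally have "card {x\<in>z. p x \<in> S} \<le> card W + card (P \<inter> S)"
      using inj by (simp add: card_image inj_on_subset)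
    moreover have "card (j ` (P \<inter> S)) \<le> card {x\<in>z. p x \<in> S}"
      using z(1) j by (intro card_mono) (auto simp: z_def)
    then have "card (P \<inter> S) \<le> card {x\<in>z. p x \<in> S}"
      using inj by (simp add: card_image inj_on_subset)
    ultimately show ?thesis
      using P(2)[OF that] unfolding L_def by linarith
  qed
  have "\<bar>mean (\<lambda>x. indicator S (p x)) z - \<mu> S\<bar> < e" if S: "S \<in> T" for S
  proof -
    have "mean (\<lambda>x. indicator S (p x)) z = real (card {x\<in>z. p x \<in> S}) / real (card z)"
      using z(1) by (simp add: mean_def indicator_def sum.If_cases Int_def)
    moreover have "\<mu> UNIV = 1" using prob by (simp add: fin_additive_prob_def)
    ultimately show ?thesis
      using quotient_near[OF count[of S] _ \<mu> e N] count[of UNIV] S T by auto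
  qed
  with z show ?thesis by blast
qed

text \<open>
  The sets \<open>Z (T, W, e)\<close> below are nonempty by the previous lemma and directed, as one may
  enlarge \<open>T\<close> and \<open>W\<close> and shrink \<open>e\<close>. So they form a base of a proper filter.
\<close>
theorem ex_fine_representative_filter:
  assumes prob: "fin_additive_prob A \<mu>" and null: "\<And>x. {x} \<in> A \<and> \<mu> {x} = 0"
    and p: "p ` X = UNIV"
  obtains F where "fine_filter X F"
    "\<And>S. S \<in> A \<Longrightarrow> (mean (\<lambda>x. indicator S (p x)) \<longlongrightarrow> \<mu> S) F"
proof -
  define I where "I = {(T, W, e::real). finite T \<and> T \<subseteq> A \<and> finite W \<and> W \<subseteq> X \<and> 0 < e}"
  define Z where "Z = (\<lambda>(T, W, e). {z. finite z \<and> W \<subseteq> z \<and> z \<subseteq> X \<and>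
    (\<forall>S\<in>T. \<bar>mean (\<lambda>x. indicator S (p x)) z - \<mu> S\<bar> < e)})"
  define F where "F = (INF i\<in>I. principal (Z i))"
  have ev: "eventually Q F" if "i \<in> I" "\<And>z. z \<in> Z i \<Longrightarrow> Q z" for Q i
    unfolding F_def using that by (intro eventually_INF1[of i]) (auto simp: eventually_principal)
  have "\<exists>k\<in>I. principal (Z k) \<le> inf (principal (Z i)) (principal (Z j))"
    if ij: "i \<in> I" "j \<in> I" for i j
  proof -
    obtain T W e T' W' e' where eq: "i = (T, W, e)" "j = (T', W', e')"
      by (metis prod_cases3)
    have "(T \<union> T', W \<union> W', min e e') \<in> I"
      "Z (T \<union> T', W \<union> W', min e e') \<subseteq> Z i \<inter> Z j"
      using ij by (auto simp: eq I_def Z_def)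
    then show ?thesis by auto
  qed
  then have "F = bot \<longleftrightarrow> (\<exists>i\<in>I. principal (Z i) = bot)"
    unfolding F_def by (rule INF_filter_bot_base)
  moreover have "Z i \<noteq> {}" if "i \<in> I" for i
  proof -
    obtain T W e where i: "i = (T, W, e)" by (metis prod_cases3)
    with that have "finite T" "T \<subseteq> A" "finite W" "W \<subseteq> X" "0 < e"
      by (auto simp: I_def)
    from ex_representative_sample[OF prob null p this] show ?thesis
      by (auto simp: i Z_def)
  qed
  ultimately have "F \<noteq> bot" by (auto simp: principal_eq_bot_iff)
  moreover have "\<forall>\<^sub>F z in F. finite z \<and> z \<subseteq> X"
    by (rule ev[of "({}, {}, 1)"]) (auto simp: I_def Z_def)
  moreover have "\<forall>\<^sub>F z in F. x \<in> z" if "x \<in> X" for x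
    by (rule ev[of "({}, {x}, 1)"]) (use that in \<open>auto simp: I_def Z_def\<close>)
  ultimately have "fine_filter X F" by (simp add: fine_filter_def)
  moreover have "(mean (\<lambda>x. indicator S (p x)) \<longlongrightarrow> \<mu> S) F" if "S \<in> A" for S
  proof (rule tendstoI)
    fix e :: real assume "0 < e"
    then show "\<forall>\<^sub>F z in F. dist (mean (\<lambda>x. indicator S (p x)) z) (\<mu> S) < e"
      by (intro ev[of "({S}, {}, e)"]) (use that in \<open>auto simp: I_def Z_def dist_real_def\<close>)
  qed
  ultimately show ?thesis by (rule that)
qed

section \<open>Means of bounded measurable functions\<close>

lemma mean_near:
  assumes "\<And>x. x \<in> z \<Longrightarrow> \<bar>h x - h' x\<bar> \<le> e" "0 \<le> e"
  shows "\<bar>mean h z - mean h' z\<bar> \<le> e"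
proof (cases "card z = 0")
  case False
  have "mean h z - mean h' z = (\<Sum>x\<in>z. h x - h' x) / card z"
    by (simp add: mean_def sum_subtractf diff_divide_distrib)
  also have "\<bar>\<dots>\<bar> \<le> (\<Sum>x\<in>z. e) / card z"
    unfolding abs_divide abs_of_nat using assms
    by (intro divide_right_mono order_trans[OF sum_abs] sum_mono) auto
  finally show ?thesis using False by simp
qed (use assms in \<open>auto simp: mean_def\<close>)

lemma mean_simple_tendsto:
  assumes rep: "\<And>S. S \<in> A \<Longrightarrow> (mean (\<lambda>x. indicator S (p x)) \<longlongrightarrow> \<mu> S) F"
    and s: "fa_simple A s"
  shows "(mean (\<lambda>x. s (p x)) \<longlongrightarrow> fa_simple_integral \<mu> s) F"
proof -
  have fin: "finite (range s)" and sets: "\<And>c. s -` {c} \<in> A"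
    using s by (auto simp: fa_simple_def)
  have s_eq: "s y = (\<Sum>c\<in>range s. c * indicator (s -` {c}) y)" for y
    using fin by (simp add: indicator_def sum.delta')
  have "mean (\<lambda>x. s (p x)) z
      = (\<Sum>c\<in>range s. c * mean (\<lambda>x. indicator (s -` {c}) (p x)) z)" for z
    unfolding mean_def
    by (subst s_eq, subst sum.swap) (simp add: sum_distrib_left sum_divide_distrib)
  then have eq: "mean (\<lambda>x. s (p x))
      = (\<lambda>z. \<Sum>c\<in>range s. c * mean (\<lambda>x. indicator (s -` {c}) (p x)) z)" by auto
  show ?thesis
    unfolding eq fa_simple_integral_def by (intro tendsto_intros rep sets)
qed

text \<open>
  Cut the range into the intervals from \<open>i / n\<close> (excluded) to \<open>(i + 1) / n\<close> (included) and round
  down to the left endpoint. Boundedness leaves finitely many intervals. Half-open intervals of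
  this orientation are the ones whose preimages are known to be in the algebra, which is why
  the rounding uses the ceiling minus one and not the floor.
\<close>
lemma bounded_measurable_uniform_limit_simple:
  assumes alg: "algebra UNIV A" and g: "bounded (range g)" "fa_measurable A g"
  obtains s where "\<And>n. fa_simple A (s n)" "uniform_limit UNIV s g sequentially"
proof -
  interpret algebra UNIV A by (rule alg)
  define s where "s n x = of_int (\<lceil>real (Suc n) * g x\<rceil> - 1) / real (Suc n)" for n x
  obtain M where M: "\<And>x. \<bar>g x\<bar> \<le> M"
    using g(1) by (auto simp: bounded_iff)
  have "fa_simple A (s n)" for n
    unfolding fa_simple_def
  proof
    define B where "B = \<lceil>real (Suc n) * M\<rceil>"
    have "\<lceil>real (Suc n) * g x\<rceil> \<in> {- B..B}" for x
    proof -
      have "\<bar>real (Suc n) * g x\<bar> \<le> real (Suc n) * M"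
        unfolding abs_mult using M by (intro mult_mono) auto
      then show ?thesis unfolding B_def by (simp del: of_nat_Suc) linarith
    qed
    then have "range (s n) \<subseteq> (\<lambda>i. of_int (i - 1) / real (Suc n)) ` {- B..B}"
      by (auto simp: s_def simp del: of_nat_Suc)
    then show "finite (range (s n))" by (rule finite_subset) simp
    show "\<forall>c. s n -` {c} \<in> A"
    proof
      fix c
      show "s n -` {c} \<in> A"
      proof (cases "\<exists>i::int. c = of_int i / real (Suc n)")
        case True
        then obtain i :: int where c: "c = of_int i / real (Suc n)" by blast
        have "s n x = c \<longleftrightarrow> c < g x \<and> g x \<le> of_int (i + 1) / real (Suc n)" for x
        proof -
          have "s n x = c \<longleftrightarrow> \<lceil>real (Suc n) * g x\<rceil> = i + 1"
            unfolding s_def c by (simp add: of_int_eq_iff[symmetric, where 'a=real] del: of_nat_Suc of_int_eq_iff) linarith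
          also have "\<dots> \<longleftrightarrow> of_int i < real (Suc n) * g x \<and> real (Suc n) * g x \<le> of_int (i + 1)"
            by linarith
          finally show ?thesis unfolding c by (simp add: field_simps del: of_nat_Suc)
        qed
        then have "s n -` {c} = {x. c < g x \<and> g x \<le> of_int (i + 1) / real (Suc n)}" by auto
        moreover have "c < of_int (i + 1) / real (Suc n)"
          unfolding c by (simp add: divide_strict_right_mono del: of_nat_Suc)
        ultimately show ?thesis using g(2) by (simp add: fa_measurable_def)
      next
        case False
        then have "s n -` {c} = {}" by (auto simp: s_def simp del: of_nat_Suc of_int_diff)
        then show ?thesis by simp
      qed
    qed
  qed
  moreover have "uniform_limit UNIV s g sequentially"
    unfolding uniform_limit_iff
  proof (intro allI impI)
    fix e :: real assume "0 < e"
    have "\<bar>s n x - g x\<bar> \<le> 1 / real (Suc n)" for n x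
    proof -
      have "\<bar>of_int (\<lceil>real (Suc n) * g x\<rceil> - 1) - real (Suc n) * g x\<bar> \<le> 1" by linarith
      then have "\<bar>of_int (\<lceil>real (Suc n) * g x\<rceil> - 1) - real (Suc n) * g x\<bar> / real (Suc n)
          \<le> 1 / real (Suc n)"
        by (intro divide_right_mono) auto
      moreover have "s n x - g x
          = (of_int (\<lceil>real (Suc n) * g x\<rceil> - 1) - real (Suc n) * g x) / real (Suc n)"
        unfolding s_def by (simp add: diff_divide_distrib del: of_nat_Suc)
      ultimately show ?thesis by (simp add: abs_divide del: of_nat_Suc)
    qed
    moreover have "\<forall>\<^sub>F n in sequentially. 1 / real (Suc n) < e"
      using order_tendstoD(2)[OF LIMSEQ_inverse_real_of_nat \<open>0 < e\<close>] by (simp add: inverse_eq_divide)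
    ultimately show "\<forall>\<^sub>F n in sequentially. \<forall>x\<in>UNIV. dist (s n x) (g x) < e"
      by (auto simp: dist_real_def elim!: eventually_mono intro: le_less_trans)
  qed
  ultimately show ?thesis by (rule that)
qed

text \<open>
  The integral of a simple function is a limit of means, and the inequality is clear for means.
  This avoids a common refinement of the level sets of \<open>s\<close> and \<open>t\<close>.
\<close>
lemma simple_integral_near:
  assumes rep: "\<And>S. S \<in> A \<Longrightarrow> (mean (\<lambda>x. indicator S (p x)) \<longlongrightarrow> \<mu> S) F" and "F \<noteq> bot"
    and s: "fa_simple A s" and t: "fa_simple A t" and st: "\<And>x. \<bar>s x - t x\<bar> \<le> e" and "0 \<le> e"
  shows "\<bar>fa_simple_integral \<mu> s - fa_simple_integral \<mu> t\<bar> \<le> e"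
proof (rule tendsto_upperbound)
  show "((\<lambda>z. \<bar>mean (\<lambda>x. s (p x)) z - mean (\<lambda>x. t (p x)) z\<bar>) \<longlongrightarrow>
      \<bar>fa_simple_integral \<mu> s - fa_simple_integral \<mu> t\<bar>) F"
    by (intro tendsto_intros mean_simple_tendsto[where A = A, OF rep] s t)
  show "\<forall>\<^sub>F z in F. \<bar>mean (\<lambda>x. s (p x)) z - mean (\<lambda>x. t (p x)) z\<bar> \<le> e"
    using assms by (intro always_eventually allI mean_near) auto
qed fact

text \<open>
  Replacing \<open>g\<close> by a uniformly close simple function changes all means by little, uniformly
  in the sample, so the limit along the filter and the limit of the integrals may be interchanged.
  Since limits along a proper filter are unique, this also gives uniqueness of the integral.
\<close>
lemma mean_tendsto_has_fa_integral:
  assumes rep: "\<And>S. S \<in> A \<Longrightarrow> (mean (\<lambda>x. indicator S (p x)) \<longlongrightarrow> \<mu> S) F"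
    and I: "has_fa_integral A \<mu> g I"
  shows "(mean (\<lambda>x. g (p x)) \<longlongrightarrow> I) F"
proof (rule tendstoI)
  fix e :: real assume "0 < e"
  from I obtain s where s: "\<And>i. fa_simple A (s i)" "uniform_limit UNIV s g sequentially"
      "(\<lambda>i. fa_simple_integral \<mu> (s i)) \<longlonglongrightarrow> I"
    by (auto simp: has_fa_integral_def)
  have "\<forall>\<^sub>F i in sequentially. \<forall>x\<in>UNIV. dist (s i x) (g x) < e / 3"
    using uniform_limitD[OF s(2), of "e / 3"] \<open>0 < e\<close> by simp
  moreover have "\<forall>\<^sub>F i in sequentially. dist (fa_simple_integral \<mu> (s i)) I < e / 3"
    using s(3) \<open>0 < e\<close> by (intro tendstoD) auto
  ultimately have "\<forall>\<^sub>F i in sequentially. (\<forall>x\<in>UNIV. dist (s i x) (g x) < e / 3) \<and>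
      dist (fa_simple_integral \<mu> (s i)) I < e / 3"
    by (rule eventually_conj)
  then obtain i where i: "\<And>x. \<bar>g x - s i x\<bar> \<le> e / 3" "\<bar>fa_simple_integral \<mu> (s i) - I\<bar> < e / 3"
    by (force simp: eventually_sequentially dist_real_def abs_minus_commute intro: less_imp_le)
  have "\<forall>\<^sub>F z in F. dist (mean (\<lambda>x. s i (p x)) z) (fa_simple_integral \<mu> (s i)) < e / 3"
    using mean_simple_tendsto[where A = A, OF rep s(1)] \<open>0 < e\<close> by (intro tendstoD) auto
  then show "\<forall>\<^sub>F z in F. dist (mean (\<lambda>x. g (p x)) z) I < e"
  proof eventually_elim
    case (elim z)
    have "\<bar>mean (\<lambda>x. g (p x)) z - mean (\<lambda>x. s i (p x)) z\<bar> \<le> e / 3"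
      using i(1) \<open>0 < e\<close> by (intro mean_near) auto
    with elim i(2) show ?case unfolding dist_real_def by linarith
  qed
qed

theorem mean_tendsto_fa_integral:
  assumes rep: "\<And>S. S \<in> A \<Longrightarrow> (mean (\<lambda>x. indicator S (p x)) \<longlongrightarrow> \<mu> S) F" and F: "F \<noteq> bot"
    and A: "algebra UNIV A" and g: "bounded (range g)" "fa_measurable A g"
  shows "(mean (\<lambda>x. g (p x)) \<longlongrightarrow> fa_integral A \<mu> g) F"
proof -
  obtain s where s: "\<And>i. fa_simple A (s i)" "uniform_limit UNIV s g sequentially"
    using bounded_measurable_uniform_limit_simple[OF A g] by blast
  have "Cauchy (\<lambda>i. fa_simple_integral \<mu> (s i))"
  proof (rule metric_CauchyI)
    fix e :: real assume "0 < e"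
    then obtain M where M: "\<And>i x. M \<le> i \<Longrightarrow> \<bar>s i x - g x\<bar> < e / 4"
      using s(2) unfolding uniform_limit_iff eventually_sequentially dist_real_def
      by (metis UNIV_I zero_less_divide_iff zero_less_numeral)
    have "dist (fa_simple_integral \<mu> (s i)) (fa_simple_integral \<mu> (s j)) < e" if "M \<le> i" "M \<le> j" for i j
    proof -
      have "\<bar>s i x - s j x\<bar> \<le> e / 2" for x
        using M[OF that(1), of x] M[OF that(2), of x] by linarith
      then have "\<bar>fa_simple_integral \<mu> (s i) - fa_simple_integral \<mu> (s j)\<bar> \<le> e / 2"
        using \<open>0 < e\<close> by (intro simple_integral_near[where A = A, OF rep F s(1) s(1)]) auto
      then show ?thesis using \<open>0 < e\<close> by (simp add: dist_real_def)
    qed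
    then show "\<exists>M. \<forall>m\<ge>M. \<forall>n\<ge>M.
        dist (fa_simple_integral \<mu> (s m)) (fa_simple_integral \<mu> (s n)) < e" by blast
  qed
  then obtain I where "(\<lambda>i. fa_simple_integral \<mu> (s i)) \<longlonglongrightarrow> I"
    using real_Cauchy_convergent by (auto simp: convergent_def)
  then have I: "has_fa_integral A \<mu> g I"
    using s by (auto simp: has_fa_integral_def)
  moreover have "J = I" if "has_fa_integral A \<mu> g J" for J
    using mean_tendsto_has_fa_integral[where A = A, OF rep that]
      mean_tendsto_has_fa_integral[where A = A, OF rep I]
    by (rule tendsto_unique[OF F])
  ultimately have "fa_integral A \<mu> g = I"
    unfolding fa_integral_def by (rule the_equality)
  then show ?thesis
    using mean_tendsto_has_fa_integral[where A = A, OF rep I] by simp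
qed

section \<open>Standard parts\<close>

text \<open>
  Comparison with all positive reals is the convenient form here: every positive real exceeds
  some \<open>1 / m\<close>, and errors can be halved.
\<close>
lemma infinitesimal_iff:
  fixes d :: "'k::{linordered_field, real_algebra_1}"
  shows "infinitesimal d \<longleftrightarrow> (\<forall>e>0. \<bar>d\<bar> < of_real e)"
proof (intro iffI allI impI)
  fix e :: real assume d: "infinitesimal d" and "0 < e"
  then obtain m :: nat where m: "1 < real m * e"
    using reals_Archimedean3 by blast
  have "- 1 < of_int (int m) * d" "of_int (int m) * d < 1"
    using d unfolding infinitesimal_def by blast+
  then have "of_nat m * \<bar>d\<bar> < 1"
    by (simp add: abs_if)
  also have "1 < of_nat m * (of_real e :: 'k)"
    using m of_real_less_iff_ordered_field[of 1 "real m * e", where 'k = 'k] by simp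
  finally show "\<bar>d\<bar> < of_real e"
    by (rule mult_left_less_imp_less) simp
next
  assume d: "\<forall>e>0. \<bar>d\<bar> < of_real e"
  show "infinitesimal d"
    unfolding infinitesimal_def
  proof
    fix m :: int
    define c :: real where "c = \<bar>of_int m\<bar> + 1"
    have c: "c > 0" by (simp add: c_def)
    have "of_real c * \<bar>d\<bar> < of_real c * of_real (1 / c)"
      using d c of_real_less_iff_ordered_field[of 0 c, where 'k = 'k]
      by (intro mult_strict_left_mono) auto
    also have "\<dots> = (1::'k)"
      using c by (simp flip: of_real_mult)
    finally have "of_real c * \<bar>d\<bar> < 1" .
    moreover have "of_real c = \<bar>of_int m :: 'k\<bar> + 1"
      unfolding c_def by (simp add: abs_if)
    ultimately have "\<bar>of_int m * d\<bar> < 1"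
      by (simp add: abs_mult algebra_simps)
    then show "- 1 < of_int m * d \<and> of_int m * d < 1"
      by (simp add: abs_less_iff)
  qed
qed

lemma inf_close_iff:
  fixes a b :: "'k::{linordered_field, real_algebra_1}"
  shows "inf_close a b \<longleftrightarrow> (\<forall>e>0. \<bar>a - b\<bar> < of_real e)"
  by (simp add: inf_close_def infinitesimal_iff)

lemma inf_close_sym: "inf_close a b \<Longrightarrow> inf_close b a"
  for a b :: "'k::{linordered_field, real_algebra_1}"
  by (simp add: inf_close_iff abs_minus_commute)

lemma inf_close_trans:
  fixes a b c :: "'k::{linordered_field, real_algebra_1}"
  assumes "inf_close a b" "inf_close b c"
  shows "inf_close a c"
  unfolding inf_close_iff
proof (intro allI impI)
  fix e :: real assume "0 < e"
  then have "\<bar>a - b\<bar> < of_real (e / 2)" "\<bar>b - c\<bar> < of_real (e / 2)"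
    using assms unfolding inf_close_iff by (meson half_gt_zero)+
  then have "\<bar>a - b\<bar> + \<bar>b - c\<bar> < of_real (e / 2) + of_real (e / 2)"
    by (rule add_strict_mono)
  also have "\<dots> = of_real e"
    by (simp flip: of_real_add)
  finally show "\<bar>a - c\<bar> < of_real e"
    by linarith
qed

lemma inf_close_of_real_iff:
  "inf_close (of_real r :: 'k::{linordered_field, real_algebra_1}) (of_real s) \<longleftrightarrow> r = s"
proof
  assume cl: "inf_close (of_real r :: 'k) (of_real s)"
  have "\<bar>r - s\<bar> < e" if "0 < e" for e
  proof -
    have "\<bar>of_real r - of_real s :: 'k\<bar> = of_real \<bar>r - s\<bar>"
      by (simp add: abs_if of_real_less_iff_ordered_field[of _ 0, where 'k = 'k, simplified]
          flip: of_real_diff)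
    then show ?thesis
      using cl that unfolding inf_close_iff by (simp add: of_real_less_iff_ordered_field)
  qed
  from this[of "\<bar>r - s\<bar>"] show "r = s" by auto
qed (auto simp: inf_close_iff of_real_less_iff_ordered_field[of 0, where 'k = 'k, simplified])

lemma elem_st_unique:
  fixes a :: "'k::{linordered_field, real_algebra_1}"
  assumes "inf_close a (of_real r)"
  shows "elem_st a = r"
  unfolding elem_st_def
proof (rule the_equality)
  fix s assume "inf_close a (of_real s)"
  with assms show "s = r"
    using inf_close_of_real_iff inf_close_sym inf_close_trans by blast
qed fact

text \<open>
  The standard part of \<open>a\<close> is the cut that \<open>a\<close> determines in the reals.
\<close>
lemma inf_close_elem_st:
  fixes a :: "'k::{linordered_field, real_algebra_1}"
  assumes "fin_elem a"
  shows "inf_close a (of_real (elem_st a))"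
proof -
  obtain m :: nat where m: "- of_nat m < a" "a < of_nat m"
    using assms by (auto simp: fin_elem_def)
  define L where "L = {q::real. of_real q < a}"
  have "- real m \<in> L" using m by (simp add: L_def)
  then have L_ne: "L \<noteq> {}" by blast
  have L_le: "q \<le> real m" if "q \<in> L" for q
  proof -
    have "(of_real q :: 'k) < of_real (real m)" using that m by (simp add: L_def)
    then show ?thesis by (simp only: of_real_less_iff_ordered_field)
  qed
  then have bdd: "bdd_above L" by (auto simp: bdd_above_def)
  have "\<bar>a - of_real (Sup L)\<bar> < of_real e" if e: "0 < e" for e
  proof -
    obtain q where q: "q \<in> L" "Sup L - e < q"
      using less_cSupD[OF L_ne, of "Sup L - e"] e by auto
    then have "(of_real (Sup L - e) :: 'k) < of_real q"
      by (simp only: of_real_less_iff_ordered_field)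
    also have "\<dots> < a" using q by (simp add: L_def)
    finally have lower: "of_real (Sup L - e) < a" .
    have "Sup L + e / 2 \<notin> L"
      using cSup_upper[OF _ bdd, of "Sup L + e / 2"] that by auto
    then have "a \<le> of_real (Sup L + e / 2)" by (simp add: L_def)
    also have "\<dots> < of_real (Sup L + e)"
      using that by (simp only: of_real_less_iff_ordered_field)
    finally show ?thesis using lower by (simp add: abs_less_iff algebra_simps)
  qed
  then have close: "inf_close a (of_real (Sup L))" by (simp add: inf_close_iff)
  with elem_st_unique[OF close] show ?thesis by simp
qed

lemma elem_st_eq_iff:
  fixes a b :: "'k::{linordered_field, real_algebra_1}"
  assumes "fin_elem a" "fin_elem b"
  shows "elem_st a = elem_st b \<longleftrightarrow> inf_close a b"
  using inf_close_elem_st[OF assms(1)] inf_close_elem_st[OF assms(2)]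
  by (metis elem_st_unique inf_close_sym inf_close_trans)

lemma vec_st_fin_vecs:
  "vec_st ` (fin_vecs :: ('k::{linordered_field, real_algebra_1} ^ 'n) set) = UNIV"
proof -
  have "x \<in> vec_st ` (fin_vecs :: ('k ^ 'n) set)" for x :: "real ^ 'n"
  proof
    let ?y = "(\<chi> i. of_real (x $ i)) :: 'k ^ 'n"
    show "x = vec_st ?y"
      by (simp add: vec_eq_iff vec_st_def elem_st_unique inf_close_of_real_iff)
    have "fin_elem (of_real r :: 'k)" for r
    proof -
      obtain m :: nat where "\<bar>r\<bar> < real m" using reals_Archimedean2 by blast
      then have "(of_real (- real m) :: 'k) < of_real r" "(of_real r :: 'k) < of_real (real m)"
        unfolding of_real_less_iff_ordered_field by auto
      then show ?thesis by (auto simp: fin_elem_def)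
    qed
    then show "?y \<in> fin_vecs" by (simp add: fin_vecs_def)
  qed
  then show ?thesis by blast
qed

text \<open>
  The value of \<open>fun_st\<close> does not depend on the chosen representative: representatives with the same
  standard part are infinitely close, and \<open>f\<close> preserves closeness.
\<close>
lemma fun_st_vec_st:
  assumes f: "standardizable X f" and X: "X \<subseteq> fin_vecs" and x: "x \<in> X"
  shows "fun_st X f (vec_st x) = elem_st (f x)"
proof -
  define y where "y = (SOME y. y \<in> X \<and> vec_st y = vec_st x)"
  have y: "y \<in> X" "vec_st y = vec_st x"
    using someI[of "\<lambda>y. y \<in> X \<and> vec_st y = vec_st x" x] x by (auto simp: y_def)
  have "elem_st (y $ i) = elem_st (x $ i)" for i
    using y(2) by (simp add: vec_st_def vec_eq_iff)
  moreover have "fin_elem (y $ i)" "fin_elem (x $ i)" for i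
    using x y(1) X by (auto simp: fin_vecs_def)
  ultimately have "vec_inf_close y x"
    by (simp add: vec_inf_close_def elem_st_eq_iff)
  then have "elem_st (f y) = elem_st (f x)"
    using f x y by (auto simp: standardizable_def elem_st_eq_iff)
  then show ?thesis by (simp add: fun_st_def y_def)
qed

lemma fun_st_near:
  assumes "standardizable X f" "X \<subseteq> fin_vecs" "x \<in> X" "0 < e"
  shows "\<bar>f x - of_real (fun_st X f (vec_st x))\<bar> < of_real e"
  using assms inf_close_elem_st[of "f x"]
  by (auto simp: fun_st_vec_st inf_close_iff standardizable_def)

section \<open>Standard parts in a power of the field\<close>

lemma of_real_divide_ordered_field:
  "(of_real (x / y) :: 'k::{linordered_field, real_algebra_1}) = of_real x / of_real y"
  by (cases "y = 0") (simp_all add: eq_divide_eq flip: of_real_mult)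

lemma of_real_of_rat:
  "(of_real (of_rat q) :: 'k::{linordered_field, real_algebra_1}) = of_rat q"
proof -
  obtain a b where "q = Fract a b" "b > 0" by (cases q)
  then show ?thesis
    by (simp add: of_rat_rat of_real_divide_ordered_field)
qed

text \<open>
  If \<open>g\<close> is eventually within every positive real of \<open>r\<close>, then all rationals above \<open>r\<close> bound
  the class of \<open>g\<close> from above and none below \<open>r\<close> does, because the filter is proper; dually
  for lower bounds. Density of the rationals yields both standard parts.
\<close>
lemma pow_class_st:
  fixes g :: "'i \<Rightarrow> 'k::{linordered_field, real_algebra_1}"
  assumes F: "F \<noteq> bot" and near: "\<And>e. 0 < e \<Longrightarrow> \<forall>\<^sub>F z in F. \<bar>g z - of_real r\<bar> < of_real e"
  shows "has_pow_st F (pow_class F g)" "pow_st F (pow_class F g) = ereal r"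
proof -
  have below: "\<forall>\<^sub>F z in F. g z < of_real q" if "r < q" for q
  proof -
    from that have "0 < q - r" by simp
    from near[OF this] show ?thesis by eventually_elim (auto simp: abs_less_iff algebra_simps)
  qed
  have above: "\<forall>\<^sub>F z in F. of_real q < g z" if "q < r" for q
  proof -
    from that have "0 < r - q" by simp
    from near[OF this] show ?thesis by eventually_elim (auto simp: abs_less_iff algebra_simps)
  qed
  have not_both: False if "\<forall>\<^sub>F z in F. g z < c" "\<forall>\<^sub>F z in F. c < g z" for c
  proof -
    have "\<forall>\<^sub>F z in F. False" using that by eventually_elim auto
    then show False using F by simp
  qed
  have plus: "pow_st_plus F (pow_class F g) = ereal r"
    unfolding pow_st_plus_def pow_const_def pow_less_class
  proof (rule antisym)
    show "Inf {ereal (of_rat q) |q. \<forall>\<^sub>F z in F. g z < of_rat q} \<le> ereal r"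
    proof (rule ereal_le_epsilon2)
      fix e :: real assume "0 < e"
      then obtain q where q: "r < of_rat q" "of_rat q < r + e"
        using of_rat_dense[of r "r + e"] by auto
      with below[of "of_rat q"]
      have "Inf {ereal (of_rat q) |q. \<forall>\<^sub>F z in F. g z < of_rat q} \<le> ereal (of_rat q)"
        by (intro Inf_lower) (auto simp: of_real_of_rat)
      with q show "Inf {ereal (of_rat q) |q. \<forall>\<^sub>F z in F. g z < of_rat q} \<le> ereal r + ereal e"
        by (auto elim: order_trans)
    qed
    show "ereal r \<le> Inf {ereal (of_rat q) |q. \<forall>\<^sub>F z in F. g z < of_rat q}"
    proof (rule Inf_greatest, clarify)
      fix q assume "\<forall>\<^sub>F z in F. g z < of_rat q"
      then have "\<not> real_of_rat q < r"
        using not_both above[of "of_rat q"] unfolding of_real_of_rat by blast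
      then show "ereal r \<le> ereal (of_rat q)" by simp
    qed
  qed
  have minus: "pow_st_minus F (pow_class F g) = ereal r"
    unfolding pow_st_minus_def pow_const_def pow_less_class
  proof (rule antisym)
    show "ereal r \<le> Sup {ereal (of_rat q) |q. \<forall>\<^sub>F z in F. of_rat q < g z}"
    proof (rule ereal_le_epsilon2)
      fix e :: real assume "0 < e"
      then obtain q where q: "r - e < of_rat q" "of_rat q < r"
        using of_rat_dense[of "r - e" r] by auto
      with above[of "of_rat q"]
      have "ereal (of_rat q) \<le> Sup {ereal (of_rat q) |q. \<forall>\<^sub>F z in F. of_rat q < g z}"
        by (intro Sup_upper) (auto simp: of_real_of_rat)
      then have "ereal (of_rat q) + ereal e
          \<le> Sup {ereal (of_rat q) |q. \<forall>\<^sub>F z in F. of_rat q < g z} + ereal e"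
        by (rule add_right_mono)
      with q show "ereal r \<le> Sup {ereal (of_rat q) |q. \<forall>\<^sub>F z in F. of_rat q < g z} + ereal e"
        by (auto elim: order_trans[rotated])
    qed
    show "Sup {ereal (of_rat q) |q. \<forall>\<^sub>F z in F. of_rat q < g z} \<le> ereal r"
    proof (rule Sup_least, clarify)
      fix q assume "\<forall>\<^sub>F z in F. of_rat q < g z"
      then have "\<not> r < real_of_rat q"
        using not_both below[of "of_rat q"] unfolding of_real_of_rat by blast
      then show "ereal (of_rat q) \<le> ereal r" by simp
    qed
  qed
  show "has_pow_st F (pow_class F g)" "pow_st F (pow_class F g) = ereal r"
    using plus minus by (auto simp: has_pow_st_def pow_st_def)
qed

lemma field_mean_near:
  fixes f :: "'a \<Rightarrow> 'k::{linordered_field, real_algebra_1}"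
  assumes near: "\<And>x. x \<in> z \<Longrightarrow> \<bar>f x - of_real (h x)\<bar> \<le> of_real e" and "0 \<le> (of_real e :: 'k)"
  shows "\<bar>1 / of_nat (card z) * (\<Sum>x\<in>z. f x) - of_real (mean h z)\<bar> \<le> of_real e"
proof (cases "card z = 0")
  case False
  have "1 / of_nat (card z) * (\<Sum>x\<in>z. f x) - of_real (mean h z)
      = (\<Sum>x\<in>z. f x - of_real (h x)) / of_nat (card z)"
    by (simp add: mean_def sum_subtractf diff_divide_distrib of_real_divide_ordered_field)
  also have "\<bar>\<dots>\<bar> \<le> (\<Sum>x\<in>z. of_real e) / of_nat (card z)"
    unfolding abs_divide abs_of_nat using near
    by (intro divide_right_mono order_trans[OF sum_abs] sum_mono) auto
  finally show ?thesis using False by simp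
qed (use assms in \<open>auto simp: mean_def\<close>)

theorem proposition21:
  fixes A :: "(real ^ 'n) set set" and \<mu> :: "(real ^ 'n) set \<Rightarrow> real"
  assumes "fin_additive_prob A \<mu>"
    and "\<And>x. {x} \<in> A \<and> \<mu> {x} = 0"
  shows "\<exists>F :: ('k::{linordered_field, real_algebra_1} ^ 'n) set filter.
    fine_filter fin_vecs F \<and>
    (\<forall>f :: 'k ^ 'n \<Rightarrow> 'k.
       standardizable fin_vecs f \<and>
       bounded (range (fun_st fin_vecs f)) \<and> fa_measurable A (fun_st fin_vecs f) \<longrightarrow>
       has_std_integral F f \<and>
       std_integral F f = ereal (fa_integral A \<mu> (fun_st fin_vecs f)))"
proof -
  obtain F :: "('k ^ 'n) set filter" where fine: "fine_filter fin_vecs F"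
    and rep: "\<And>S. S \<in> A \<Longrightarrow> (mean (\<lambda>x. indicator S (vec_st x)) \<longlongrightarrow> \<mu> S) F"
    by (rule ex_fine_representative_filter[OF assms vec_st_fin_vecs]) (rule that)
  have F: "F \<noteq> bot" and fin: "\<forall>\<^sub>F z in F. z \<subseteq> fin_vecs"
    using fine by (auto simp: fine_filter_def elim: eventually_mono)
  have "has_std_integral F f \<and>
      std_integral F f = ereal (fa_integral A \<mu> (fun_st fin_vecs f))"
    if f: "standardizable fin_vecs f" "bounded (range (fun_st fin_vecs f))"
      "fa_measurable A (fun_st fin_vecs f)" for f :: "'k ^ 'n \<Rightarrow> 'k"
  proof -
    define g where "g = fun_st fin_vecs f"
    define I where "I = fa_integral A \<mu> g"
    have lim: "(mean (\<lambda>x. g (vec_st x)) \<longlongrightarrow> I) F"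
      unfolding I_def g_def using assms(1) f
      by (intro mean_tendsto_fa_integral[where A = A, OF rep F]) (auto simp: fin_additive_prob_def)
    have "\<forall>\<^sub>F z in F. \<bar>1 / of_nat (card z) * (\<Sum>x\<in>z. f x) - of_real I\<bar> < of_real e"
      if e: "0 < e" for e
    proof -
      have "\<forall>\<^sub>F z in F. dist (mean (\<lambda>x. g (vec_st x)) z) I < e / 2"
        using lim e by (intro tendstoD) auto
      with fin show ?thesis
      proof eventually_elim
        case (elim z)
        let ?m = "mean (\<lambda>x. g (vec_st x)) z"
        have "(0::'k) < of_real (e / 2)"
          using e of_real_less_iff_ordered_field[of 0 "e / 2", where 'k = 'k] by simp
        then have avg: "\<bar>1 / of_nat (card z) * (\<Sum>x\<in>z. f x) - of_real ?m\<bar> \<le> of_real (e / 2)"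
          using elim(1) e fun_st_near[OF f(1) order_refl, of _ "e / 2"]
          by (intro field_mean_near) (auto simp: g_def intro: less_imp_le)
        have "(of_real (I - e / 2) :: 'k) < of_real ?m" "(of_real ?m :: 'k) < of_real (I + e / 2)"
          using elim(2) unfolding of_real_less_iff_ordered_field dist_real_def by linarith+
        moreover have "(of_real (I + e / 2) :: 'k) + of_real (e / 2) = of_real (I + e)"
          "(of_real (I - e / 2) :: 'k) - of_real (e / 2) = of_real (I - e)"
          by (simp_all flip: of_real_add of_real_diff)
        ultimately have "of_real (I - e) < 1 / of_nat (card z) * (\<Sum>x\<in>z. f x)"
          "1 / of_nat (card z) * (\<Sum>x\<in>z. f x) < of_real (I + e)"
          using avg unfolding abs_le_iff by linarith+
        then show ?case by (simp add: abs_less_iff algebra_simps)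
      qed
    qed
    from pow_class_st[OF F this] show ?thesis
      by (simp add: has_std_integral_def std_integral_def filter_integral_def I_def g_def)
  qed
  with fine show ?thesis by blast
qed

end
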